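(* Resonances on the dominant string are logarithmic with respect to $\operatorname{Im} z$ against $\operatorname{Re} z$, while the remaining strings are flat up to $o(h)$. For resonances $z_m$ on the dominant string, $$\operatorname{Im} z_m=-\frac{h}{x_K-x_J}\log\!\left(\frac{2\operatorname{Re} z_m}{\sqrt{|C_JC_K|}}\right)-\gamma_{JK}\,h\log(1/h)+o(h),$$ and for resonances $\tilde z_m$ on the string of $\tilde\gamma_{jk}\in\Gamma\setminus\{\gamma_{JK}\}$, with associated pair $j<k$, $$\operatorname{Im}\tilde z_m=-\frac{h}{x_k-x_j}\log\!\left(\sqrt{\left|\frac{C_j}{C_k}\right|}\right)-\tilde\gamma_{jk}\,h\log(1/h)+o(h).$$
   Context: Setting. Fix an integer $N\ge 2$ and real parameters $x_1<\dots<x_N$, $C_j\neq 0$, $\beta_j>0$ ($1\le j\le N$). For $h>0$ put $V(x)=\sum_{j=1}^N C_jh^{1+\beta_j}\delta(x-x_j)$ on $\mathbb{R}$. Resonances. A resonance (for a given $h>0$) is a $z\in\mathbb{C}\setminus\{0\}$ for which $(-h^2\partial_x^2+V-z^2)u=0$ has a nonzero outgoing solution. Explicitly (with $x_0=-\infty$, $x_{N+1}=+\infty$): there are coefficients $v_j^\pm$, not all zero, with $v_0^+=v_N^-=0$, such that $u(x)=v_j^+e^{izx/h}+v_j^-e^{-izx/h}$ on $(x_j,x_{j+1})$ for $0\le j\le N$ satisfies $u(x_j^-)=u(x_j^+)$ and $h^2\big(u'(x_j^-)-u'(x_j^+)\big)+C_jh^{1+\beta_j}u(x_j)=0$ for $1\le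 j\le N$. Newton polygon. Let $P=\{(2(x_k-x_j),\,\beta_j+\beta_k):1\le j<k\le N\}\cup\{(0,0)\}\subset\mathbb{R}^2$, with points written $(\lambda,\nu)$. The Newton polygon is the convex hull of the epigraph $\{(\lambda,t):(\lambda,\nu)\in P,\ t\ge\nu\}$. $\Gamma$ is the (finite) set of its non-infinite slopes, i.e. the slopes of the non-vertical edges of its boundary. Standing assumption. The non-infinite slopes of the Newton polygon are unique, in the sense that for any three collinear points of $P$ at least one lies in the interior of the Newton polygon. Slopes. For $1\le j<k\le N$ put $\gamma_{jk}=\dfrac{\beta_k+\beta_j}{2(x_k-x_j)}$ and $\tilde\gamma_{jk}=\dfrac{|\beta_k-\beta_j|}{2(x_k-x_j)}$. Dominant pair. The dominant pair $(J,K)$, $J<K$, is the pair minimizing $\gamma_{jk}$ among all pairs $j<k$ (unique by the standing assumption). $\gamma_{JK}$ is the slope of the edge starting at the origin and is the smallest element of $\Gamma$. Pair associated with a slope. Under the standing assumption, each vertex of the polygon other than the origin comes from exactly one pair of indices, and the pairs at the two endpoints of a non-vertical edge not starting at the origin share exactly one index. For $\gamma\in\Gamma\setminus\{\gamma_{JK}\}$, the associated pair $j<k$ consists of the two indices not shared by the endpoints of the edge of slope $\gamma$; then $\gamma=\tilde\gamma_{jk}$. Strings. Let $M$ be large and fixed, and $h$ small depending on $M$. The resonances $z_m$ on the dominant string are those given, for integers $m$ with $\frac{\pi hm}{x_K-x_J}\in[\frac2M,\frac M2]$, by $$z_m=\frac{\pi h m}{x_K-x_J}-i\gamma_{JK}h\log(1/h)+\frac{ih}{2(x_K-x_J)}\log\!\left(\frac{-C_JC_K(x_K-x_J)^2}{4\pi^2h^2m^2}\right)+o(h).$$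 The resonances $\tilde z_m$ on the string of $\tilde\gamma_{jk}\in\Gamma\setminus\{\gamma_{JK}\}$ are those given, for integers $m$ with $\frac{\pi hm}{x_k-x_j}\in[\frac2M,\frac M2]$, by $$\tilde z_m=\frac{\pi h m}{x_k-x_j}-i\tilde\gamma_{jk}h\log(1/h)+\frac{ih}{2(x_k-x_j)}\log\!\left(\frac{-C_j}{C_k}\right)+o(h).$$ In these two displays $\log$ is a fixed branch of the complex logarithm. The $o(h)$ terms are as $h\to0$ with $M$ fixed.
   Formalization: The second formula is proved with |C_k/C_j| in place of |C_j/C_k|, since the printed sign contradicts the given expansion of the string; the printed formula is proved only for β_j<β_k and strings given with log(-C_k/C_j) instead of log(-C_j/C_k). *)

theory Defs
  imports "HOL-Analysis.Analysis" "HOL-Library.Landau_Symbols"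
begin

(* Positions x, strengths C and exponents \<beta> are functions on nat of which only the values at
   1, ..., N matter.  The j-th branch of a solution lives on the interval (x j, x (j+1)) for
   0 \<le> j \<le> N, with x 0 and x (N+1) read as minus and plus infinity.  Every branch is an entire
   function, so one-sided limits of u and u' at x j are values of the adjacent branches there. *)

definition branch ::
  "(nat \<Rightarrow> complex) \<Rightarrow> (nat \<Rightarrow> complex) \<Rightarrow> real \<Rightarrow> complex \<Rightarrow> nat \<Rightarrow> complex \<Rightarrow> complex" where
  "branch vp vm h z j y =
     vp j * exp (\<i> * z * y / of_real h) + vm j * exp (- (\<i> * z * y / of_real h))"

definition resonance ::
  "nat \<Rightarrow> (nat \<Rightarrow> real) \<Rightarrow> (nat \<Rightarrow> real) \<Rightarrow> (nat \<Rightarrow> real) \<Rightarrow> real \<Rightarrow> complex \<Rightarrow> bool" where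
  "resonance N x C \<beta> h z \<longleftrightarrow> z \<noteq> 0 \<and>
     (\<exists>vp vm. (\<exists>j\<le>N. vp j \<noteq> 0 \<or> vm j \<noteq> 0) \<and> vp 0 = 0 \<and> vm N = 0 \<and>
       (\<forall>j\<in>{1..N}.
          branch vp vm h z (j - 1) (of_real (x j)) = branch vp vm h z j (of_real (x j)) \<and>
          of_real (h\<^sup>2) * (deriv (branch vp vm h z (j - 1)) (of_real (x j))
                         - deriv (branch vp vm h z j) (of_real (x j)))
            + of_real (C j * h powr (1 + \<beta> j)) * branch vp vm h z j (of_real (x j)) = 0))"


definition pair_point :: "(nat \<Rightarrow> real) \<Rightarrow> (nat \<Rightarrow> real) \<Rightarrow> nat \<Rightarrow> nat \<Rightarrow> real \<times> real" where
  "pair_point x \<beta> j k = (2 * (x k - x j), \<beta> j + \<beta> k)"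

definition newton_points :: "nat \<Rightarrow> (nat \<Rightarrow> real) \<Rightarrow> (nat \<Rightarrow> real) \<Rightarrow> (real \<times> real) set" where
  "newton_points N x \<beta> =
     {pair_point x \<beta> j k | j k. 1 \<le> j \<and> j < k \<and> k \<le> N} \<union> {(0, 0)}"

definition newton_polygon :: "nat \<Rightarrow> (nat \<Rightarrow> real) \<Rightarrow> (nat \<Rightarrow> real) \<Rightarrow> (real \<times> real) set" where
  "newton_polygon N x \<beta> =
     convex hull {(l, t) | l t. \<exists>\<nu>. (l, \<nu>) \<in> newton_points N x \<beta> \<and> \<nu> \<le> t}"

(* The edges of the polygon not of this form are its two vertical boundary rays. *)

definition slanted_edge ::
  "nat \<Rightarrow> (nat \<Rightarrow> real) \<Rightarrow> (nat \<Rightarrow> real) \<Rightarrow> real \<times> real \<Rightarrow> real \<times> real \<Rightarrow> bool" where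
  "slanted_edge N x \<beta> a b \<longleftrightarrow>
     fst a < fst b \<and> closed_segment a b edge_of newton_polygon N x \<beta>"

definition slope :: "real \<times> real \<Rightarrow> real \<times> real \<Rightarrow> real" where
  "slope a b = (snd b - snd a) / (fst b - fst a)"

definition newton_slopes :: "nat \<Rightarrow> (nat \<Rightarrow> real) \<Rightarrow> (nat \<Rightarrow> real) \<Rightarrow> real set" where
  "newton_slopes N x \<beta> = {slope a b | a b. slanted_edge N x \<beta> a b}"

definition unique_slopes :: "nat \<Rightarrow> (nat \<Rightarrow> real) \<Rightarrow> (nat \<Rightarrow> real) \<Rightarrow> bool" where
  "unique_slopes N x \<beta> \<longleftrightarrow>
     (\<forall>p\<in>newton_points N x \<beta>. \<forall>q\<in>newton_points N x \<beta>. \<forall>r\<in>newton_points N x \<beta>.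
        p \<noteq> q \<and> q \<noteq> r \<and> p \<noteq> r \<and> collinear {p, q, r} \<longrightarrow>
        (\<exists>s\<in>{p, q, r}. s \<in> interior (newton_polygon N x \<beta>)))"

definition gam :: "(nat \<Rightarrow> real) \<Rightarrow> (nat \<Rightarrow> real) \<Rightarrow> nat \<Rightarrow> nat \<Rightarrow> real" where
  "gam x \<beta> j k = (\<beta> k + \<beta> j) / (2 * (x k - x j))"

definition gam_tilde :: "(nat \<Rightarrow> real) \<Rightarrow> (nat \<Rightarrow> real) \<Rightarrow> nat \<Rightarrow> nat \<Rightarrow> real" where
  "gam_tilde x \<beta> j k = \<bar>\<beta> k - \<beta> j\<bar> / (2 * (x k - x j))"

definition dominant_pair ::
  "nat \<Rightarrow> (nat \<Rightarrow> real) \<Rightarrow> (nat \<Rightarrow> real) \<Rightarrow> nat \<Rightarrow> nat \<Rightarrow> bool" where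
  "dominant_pair N x \<beta> J K \<longleftrightarrow> 1 \<le> J \<and> J < K \<and> K \<le> N \<and>
     (\<forall>j k. 1 \<le> j \<and> j < k \<and> k \<le> N \<longrightarrow> gam x \<beta> J K \<le> gam x \<beta> j k)"

definition associated_pair ::
  "nat \<Rightarrow> (nat \<Rightarrow> real) \<Rightarrow> (nat \<Rightarrow> real) \<Rightarrow> real \<Rightarrow> nat \<Rightarrow> nat \<Rightarrow> bool" where
  "associated_pair N x \<beta> g j k \<longleftrightarrow> j < k \<and>
     (\<exists>j1 k1 j2 k2. 1 \<le> j1 \<and> j1 < k1 \<and> k1 \<le> N \<and> 1 \<le> j2 \<and> j2 < k2 \<and> k2 \<le> N \<and>
        slanted_edge N x \<beta> (pair_point x \<beta> j1 k1) (pair_point x \<beta> j2 k2) \<and>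
        slope (pair_point x \<beta> j1 k1) (pair_point x \<beta> j2 k2) = g \<and>
        {j, k} = ({j1, k1} - {j2, k2}) \<union> ({j2, k2} - {j1, k1}))"


(* A branch of the logarithm with a cut along a ray: the argument is taken in (\<theta>, \<theta> + 2 pi]. *)

definition log_branch :: "(complex \<Rightarrow> complex) \<Rightarrow> bool" where
  "log_branch lg \<longleftrightarrow>
     (\<exists>\<theta>. \<forall>w. w \<noteq> 0 \<longrightarrow> exp (lg w) = w \<and> Im (lg w) \<in> {\<theta><..\<theta> + 2 * pi})"

(* h tends to 0 from the right while m ranges over all integers with pi h m / L in [2/M, M/2].
   Thus o(h) with respect to this filter is o(h) as h tends to 0, uniformly in these m. *)

definition string_filter :: "real \<Rightarrow> real \<Rightarrow> (real \<times> int) filter" where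
  "string_filter M L =
     inf (filtercomap fst (at_right 0))
         (principal {(h, m). pi * h * of_int m / L \<in> {2 / M..M / 2}})"

definition dominant_string ::
  "nat \<Rightarrow> (nat \<Rightarrow> real) \<Rightarrow> (nat \<Rightarrow> real) \<Rightarrow> (nat \<Rightarrow> real) \<Rightarrow> real \<Rightarrow> (complex \<Rightarrow> complex) \<Rightarrow>
   nat \<Rightarrow> nat \<Rightarrow> (real \<Rightarrow> int \<Rightarrow> complex) \<Rightarrow> bool" where
  "dominant_string N x C \<beta> M lg J K z \<longleftrightarrow>
     (\<forall>\<^sub>F (h, m) in string_filter M (x K - x J). resonance N x C \<beta> h (z h m)) \<and>
     (\<lambda>(h, m). z h m -
        (of_real (pi * h * of_int m / (x K - x J))
         - \<i> * of_real (gam x \<beta> J K * h * ln (1 / h))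
         + \<i> * of_real h / of_real (2 * (x K - x J))
             * lg (of_real (- (C J) * C K * (x K - x J)\<^sup>2 / (4 * pi\<^sup>2 * h\<^sup>2 * (of_int m)\<^sup>2)))))
     \<in> o[string_filter M (x K - x J)](\<lambda>(h, m). of_real h)"

(* \<rho> is the ratio under the logarithm.  If r j denotes the leading term C j h^(\<beta> j) / (2 i z) of the
   reflection coefficient at x j, an edge whose endpoints share an index l corresponds to the balance
   exp (2 i z (x k - x j) / h) = - r k / r j  if l lies to the right of j < k  (then \<beta> j > \<beta> k),
   exp (2 i z (x k - x j) / h) = - r j / r k  if l lies to the left of j < k   (then \<beta> j < \<beta> k).
   Solving for z gives \<rho> = C j / C k in the first case and \<rho> = C k / C j in the second. *)

definition flat_string ::
  "nat \<Rightarrow> (nat \<Rightarrow> real) \<Rightarrow> (nat \<Rightarrow> real) \<Rightarrow> (nat \<Rightarrow> real) \<Rightarrow> real \<Rightarrow> (complex \<Rightarrow> complex) \<Rightarrow>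
   nat \<Rightarrow> nat \<Rightarrow> real \<Rightarrow> (real \<Rightarrow> int \<Rightarrow> complex) \<Rightarrow> bool" where
  "flat_string N x C \<beta> M lg j k \<rho> z \<longleftrightarrow>
     (\<forall>\<^sub>F (h, m) in string_filter M (x k - x j). resonance N x C \<beta> h (z h m)) \<and>
     (\<lambda>(h, m). z h m -
        (of_real (pi * h * of_int m / (x k - x j))
         - \<i> * of_real (gam_tilde x \<beta> j k * h * ln (1 / h))
         + \<i> * of_real h / of_real (2 * (x k - x j)) * lg (of_real (- \<rho>))))
     \<in> o[string_filter M (x k - x j)](\<lambda>(h, m). of_real h)"

end

theory Submission
  imports Defs
begin

text \<open>
  Both expansions come from taking imaginary parts in the asymptotic formulas for the strings.  Every
  branch of the logarithm has real part \<open>ln (cmod w)\<close> (lemma \<open>Re_log_branch\<close>), so the choice of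
  branch does not affect the imaginary part of the term \<open>\<i> h log w / (2 L)\<close>, which is
  \<open>h ln \<bar>w\<bar> / (2 L)\<close>.  For a flat string \<open>\<bar>w\<bar>\<close> is a ratio of two strengths, and the
  claim is an identity up to the imaginary part of the remainder.

  On the dominant string \<open>\<bar>w\<bar>\<close> depends on \<open>m\<close>, through the leading real part
  \<open>a = pi h m / L\<close>: one has \<open>\<bar>w\<bar> = \<bar>C J * C K\<bar> / (4 * a\<^sup>2)\<close>, so that
  \<open>ln \<bar>w\<bar> = - 2 * ln (2 * a / sqrt \<bar>C J * C K\<bar>)\<close>.  It remains to replace \<open>a\<close> by
  \<open>Re z\<close>.  Because a branch of the logarithm has bounded imaginary part, \<open>Re z - a\<close>
  is \<open>O(h)\<close>; because \<open>a\<close> stays above \<open>2 / M\<close>, the quotient \<open>Re z / a\<close> tends to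
  \<open>1\<close> and \<open>ln (Re z) - ln a\<close> to \<open>0\<close> (lemma \<open>ln_diff_tendsto_0\<close>).  The factor
  \<open>h / L\<close> in front turns this into an error \<open>o(h)\<close>.
\<close>

text \<open>Only the imaginary part of a logarithm depends on the branch.\<close>
lemma Re_log_branch:
  assumes "log_branch lg" "w \<noteq> 0"
  shows "Re (lg w) = ln (cmod w)"
proof -
  have "exp (lg w) = w" using assms unfolding log_branch_def by blast
  then have "cmod w = exp (Re (lg w))" by (metis norm_exp_eq_Re)
  then show ?thesis by simp
qed

lemma Im_log_branch_bounded:
  assumes "log_branch lg"
  obtains B where "\<And>w. w \<noteq> 0 \<Longrightarrow> \<bar>Im (lg w)\<bar> \<le> B"
proof -
  obtain \<theta> where \<theta>: "\<And>w. w \<noteq> 0 \<Longrightarrow> Im (lg w) \<in> {\<theta><..\<theta> + 2 * pi}"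
    using assms unfolding log_branch_def by blast
  have "\<bar>Im (lg w)\<bar> \<le> \<bar>\<theta>\<bar> + 2 * pi" if "w \<noteq> 0" for w
    using \<theta>[OF that] pi_gt_zero by auto
  then show thesis by (rule that)
qed

lemma Re_smallo:
  assumes "f \<in> o[F](\<lambda>p. complex_of_real (g p))"
  shows "(\<lambda>p. Re (f p)) \<in> o[F](g)"
proof (rule landau_o.smallI)
  fix c :: real assume "c > 0"
  from landau_o.smallD[OF assms this]
  show "\<forall>\<^sub>F p in F. norm (Re (f p)) \<le> c * norm (g p)"
    by eventually_elim (use abs_Re_le_cmod order_trans in fastforce)
qed

lemma Im_smallo:
  assumes "f \<in> o[F](\<lambda>p. complex_of_real (g p))"
  shows "(\<lambda>p. Im (f p)) \<in> o[F](g)"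
proof (rule landau_o.smallI)
  fix c :: real assume "c > 0"
  from landau_o.smallD[OF assms this]
  show "\<forall>\<^sub>F p in F. norm (Im (f p)) \<le> c * norm (g p)"
    by eventually_elim (use abs_Im_le_cmod order_trans in fastforce)
qed

text \<open>
  A lower bound \<open>c > 0\<close> turns the absolute convergence \<open>f - a \<longlonglongrightarrow> 0\<close> into the
  relative one \<open>f / a \<longlonglongrightarrow> 1\<close>, to which continuity of \<open>ln\<close> at \<open>1\<close> applies.
\<close>
lemma ln_diff_tendsto_0:
  fixes f a :: "'a \<Rightarrow> real"
  assumes diff: "((\<lambda>p. f p - a p) \<longlongrightarrow> 0) F"
    and "c > 0" and lower: "\<forall>\<^sub>F p in F. c \<le> a p"
  shows "((\<lambda>p. ln (f p) - ln (a p)) \<longlongrightarrow> 0) F"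
proof -
  have "((\<lambda>p. (f p - a p) / a p) \<longlongrightarrow> 0) F"
  proof (rule Lim_null_comparison)
    show "\<forall>\<^sub>F p in F. norm ((f p - a p) / a p) \<le> \<bar>f p - a p\<bar> / c"
      using lower
    proof eventually_elim
      case (elim p)
      then show ?case using \<open>c > 0\<close> by (auto simp: abs_divide intro!: divide_left_mono)
    qed
    show "((\<lambda>p. \<bar>f p - a p\<bar> / c) \<longlongrightarrow> 0) F"
      using tendsto_divide[OF tendsto_rabs[OF diff] tendsto_const, of c] \<open>c > 0\<close> by simp
  qed
  from tendsto_add[OF tendsto_const[of 1] this]
  have one: "((\<lambda>p. 1 + (f p - a p) / a p) \<longlongrightarrow> 1) F" by simp
  have lim: "((\<lambda>p. ln (1 + (f p - a p) / a p)) \<longlongrightarrow> 0) F"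
    using tendsto_ln[OF one] by simp
  have "\<forall>\<^sub>F p in F. 0 < 1 + (f p - a p) / a p"
    using order_tendstoD(1)[OF one] by simp
  with lower have "\<forall>\<^sub>F p in F. ln (1 + (f p - a p) / a p) = ln (f p) - ln (a p)"
  proof eventually_elim
    case (elim p)
    with \<open>c > 0\<close> have "a p > 0" by linarith
    then have "1 + (f p - a p) / a p = f p / a p" by (simp add: field_simps)
    with elim \<open>a p > 0\<close> show ?case
      by (simp add: ln_div zero_less_divide_iff)
  qed
  with lim show ?thesis by (simp cong: tendsto_cong)
qed

lemma filterlim_fst_string_filter: "filterlim fst (at_right 0) (string_filter M L)"
  unfolding string_filter_def by (rule filterlim_mono[OF filterlim_filtercomap order_refl inf_le1])

lemma eventually_string_filter:
  "\<forall>\<^sub>F p in string_filter M L. 0 < fst p \<and> pi * fst p * of_int (snd p) / L \<in> {2 / M..M / 2}"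
proof (rule eventually_conj)
  show "\<forall>\<^sub>F p in string_filter M L. 0 < fst p"
    using filterlim_fst_string_filter[of M L] by (auto simp: filterlim_at elim: eventually_mono)
  show "\<forall>\<^sub>F p in string_filter M L. pi * fst p * of_int (snd p) / L \<in> {2 / M..M / 2}"
    unfolding string_filter_def
    by (rule filter_leD[OF inf_le2]) (simp add: eventually_principal)
qed

lemma Re_i_times_of_real_mult: "Re (\<i> * (of_real c * w)) = - c * Im w"
  and Im_i_times_of_real_mult: "Im (\<i> * (of_real c * w)) = c * Re w"
  by simp_all

text \<open>
  With \<open>\<rho>\<close> real and independent of \<open>m\<close>, the claim is the imaginary part of the defining
  expansion; the sign in \<open>- ln (sqrt \<bar>inverse \<rho>\<bar>) = ln \<bar>\<rho>\<bar> / 2\<close> is why the inverse appears.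
\<close>
lemma flat_string_Im:
  assumes lg: "log_branch lg" and "\<rho> \<noteq> 0"
    and "flat_string N x C \<beta> M lg j k \<rho> z"
  shows "(\<lambda>(h, m). Im (z h m) -
           (- (h / (x k - x j)) * ln (sqrt \<bar>inverse \<rho>\<bar>)
            - gam_tilde x \<beta> j k * h * ln (1 / h)))
        \<in> o[string_filter M (x k - x j)](\<lambda>(h, m). h)"
proof -
  have Re_lg: "Re (lg (of_real (- \<rho>))) = ln \<bar>\<rho>\<bar>"
    using Re_log_branch[OF lg, of "of_real (- \<rho>)"] \<open>\<rho> \<noteq> 0\<close> by simp
  have "ln (sqrt \<bar>inverse \<rho>\<bar>) = - ln \<bar>\<rho>\<bar> / 2"
    using \<open>\<rho> \<noteq> 0\<close> by (simp add: ln_sqrt ln_inverse abs_inverse)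
  moreover have "(\<lambda>p. Im (z (fst p) (snd p) -
        (of_real (pi * fst p * of_int (snd p) / (x k - x j))
         - \<i> * of_real (gam_tilde x \<beta> j k * fst p * ln (1 / fst p))
         + \<i> * of_real (fst p) / of_real (2 * (x k - x j)) * lg (of_real (- \<rho>)))))
     \<in> o[string_filter M (x k - x j)](fst)"
    using assms(3) unfolding flat_string_def case_prod_beta'
    by (intro Im_smallo) simp
  moreover have "Im (\<i> * of_real h / of_real (2 * (x k - x j)) * lg (of_real (- \<rho>)))
      = h / (2 * (x k - x j)) * Re (lg (of_real (- \<rho>)))" for h
  proof -
    have "\<i> * of_real h / of_real (2 * (x k - x j)) * lg (of_real (- \<rho>))
      = \<i> * (of_real (h / (2 * (x k - x j))) * lg (of_real (- \<rho>)))" by simp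
    then show ?thesis by (simp only: Im_i_times_of_real_mult)
  qed
  ultimately show ?thesis
    unfolding case_prod_beta'
    by (simp add: Re_lg algebra_simps del: of_real_mult of_real_diff of_real_minus of_real_divide)
qed

text \<open>
  Here \<open>a\<close> is the leading real part, \<open>w\<close> the argument of the logarithm, \<open>S\<close> the constant
  \<open>sqrt \<bar>C J * C K\<bar>\<close> and \<open>r\<close> the remainder.  The imaginary part of the expansion is the claim with
  \<open>a\<close> in place of \<open>Re z\<close>, and the replacement costs
  \<open>h / L * (ln (Re z) - ln a)\<close>.
\<close>
lemma dominant_string_Im:
  assumes lg: "log_branch lg" and "M > 0" and "x J < x K" and "C J \<noteq> 0" and "C K \<noteq> 0"
    and dom: "dominant_string N x C \<beta> M lg J K z"
  shows "(\<lambda>(h, m). Im (z h m) -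
         (- (h / (x K - x J)) * ln (2 * Re (z h m) / sqrt \<bar>C J * C K\<bar>)
          - gam x \<beta> J K * h * ln (1 / h)))
      \<in> o[string_filter M (x K - x J)](\<lambda>(h, m). h)"
proof -
  define L where "L = x K - x J"
  define F where "F = string_filter M L"
  define a where "a p = pi * fst p * of_int (snd p) / L" for p :: "real \<times> int"
  define w where "w p = - (C J) * C K * L\<^sup>2 / (4 * pi\<^sup>2 * (fst p)\<^sup>2 * (of_int (snd p))\<^sup>2)"
    for p :: "real \<times> int"
  define Z where "Z p = z (fst p) (snd p)" for p
  define r where "r p = Z p - (of_real (a p) - \<i> * of_real (gam x \<beta> J K * fst p * ln (1 / fst p))
      + \<i> * (of_real (fst p / (2 * L)) * lg (of_real (w p))))" for p
  define S where "S = sqrt \<bar>C J * C K\<bar>"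
  have "L > 0" using \<open>x J < x K\<close> by (simp add: L_def)
  have "S > 0" using \<open>C J \<noteq> 0\<close> \<open>C K \<noteq> 0\<close> by (simp add: S_def)
  have r: "r \<in> o[F](\<lambda>p. of_real (fst p))"
    using dom
    unfolding dominant_string_def case_prod_beta' F_def r_def a_def w_def Z_def L_def
    by (simp add: mult.assoc)
  have ev: "\<forall>\<^sub>F p in F. 0 < fst p \<and> 2 / M \<le> a p"
    using eventually_string_filter[where M = M and L = L] unfolding F_def a_def
    by eventually_elim simp
  have h_lim: "(fst \<longlongrightarrow> 0) F"
    using filterlim_fst_string_filter unfolding F_def by (simp add: filterlim_at)
  have a_pos: "0 < a p" if "2 / M \<le> a p" for p
    using that \<open>M > 0\<close> by (meson divide_pos_pos less_le_trans zero_less_numeral)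
  have abs_w: "\<bar>w p\<bar> = (S / (2 * a p))\<^sup>2" for p
    using \<open>L > 0\<close>
    by (simp add: w_def a_def S_def power_mult_distrib power_divide abs_mult abs_divide)
  have w_nz: "w p \<noteq> 0" if "0 < a p" for p
    using abs_w[of p] that \<open>S > 0\<close> by auto
  have Re_Z: "Re (Z p) = a p - fst p / (2 * L) * Im (lg (of_real (w p))) + Re (r p)" for p
    unfolding r_def
    by (simp del: of_real_mult of_real_divide add: Re_i_times_of_real_mult Im_i_times_of_real_mult)
  have Im_Z: "Im (Z p) = - gam x \<beta> J K * fst p * ln (1 / fst p)
      + fst p / (2 * L) * Re (lg (of_real (w p))) + Im (r p)" for p
    unfolding r_def
    by (simp del: of_real_mult of_real_divide add: Re_i_times_of_real_mult Im_i_times_of_real_mult)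

  obtain B where B: "\<And>w. w \<noteq> 0 \<Longrightarrow> \<bar>Im (lg w)\<bar> \<le> B"
    using Im_log_branch_bounded[OF lg] by blast
  have Re_lim: "((\<lambda>p. Re (Z p) - a p) \<longlongrightarrow> 0) F"
  proof (rule Lim_null_comparison)
    have "\<forall>\<^sub>F p in F. \<bar>Re (r p)\<bar> \<le> \<bar>fst p\<bar>"
      using landau_o.smallD[OF Re_smallo[OF r], of 1] by simp
    with ev show "\<forall>\<^sub>F p in F. norm (Re (Z p) - a p) \<le> fst p * (B / (2 * L) + 1)"
    proof eventually_elim
      case (elim p)
      then have "\<bar>Im (lg (of_real (w p)))\<bar> \<le> B"
        using B[of "of_real (w p)"] w_nz[OF a_pos, of p] by simp
      then have "\<bar>fst p / (2 * L) * Im (lg (of_real (w p)))\<bar> \<le> fst p / (2 * L) * B"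
        using elim \<open>L > 0\<close> by (simp add: abs_mult abs_divide mult_left_mono divide_right_mono)
      with elim have "norm (Re (Z p) - a p) \<le> fst p / (2 * L) * B + fst p"
        unfolding Re_Z real_norm_def by linarith
      then show ?case by (simp add: algebra_simps)
    qed
    show "((\<lambda>p. fst p * (B / (2 * L) + 1)) \<longlongrightarrow> 0) F"
      by (rule tendsto_mult_left_zero[OF h_lim])
  qed
  have "((\<lambda>p. ln (Re (Z p)) - ln (a p)) \<longlongrightarrow> 0) F"
    using ev \<open>M > 0\<close>
    by (intro ln_diff_tendsto_0[OF Re_lim, of "2 / M"]) (auto elim: eventually_mono)
  then have "(\<lambda>p. ln (Re (Z p)) - ln (a p)) \<in> o[F](\<lambda>_. 1)"
    by (intro smalloI_tendsto) auto
  then have "(\<lambda>p. fst p / L * (ln (Re (Z p)) - ln (a p))) \<in> o[F](\<lambda>p. fst p / L * 1)"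
    by (intro landau_o.small.mult_left)
  then have "(\<lambda>p. fst p / L * (ln (Re (Z p)) - ln (a p))) \<in> o[F](fst)"
    using \<open>L > 0\<close> by simp
  then have small: "(\<lambda>p. Im (r p) + fst p / L * (ln (Re (Z p)) - ln (a p))) \<in> o[F](fst)"
    by (intro sum_in_smallo Im_smallo[OF r])
  have "\<forall>\<^sub>F p in F. - (2 / M) < Re (Z p) - a p"
    using \<open>M > 0\<close> by (intro order_tendstoD(1)[OF Re_lim]) simp
  with ev have Re_pos: "\<forall>\<^sub>F p in F. 0 < Re (Z p)"
    by eventually_elim linarith
  have "\<forall>\<^sub>F p in F. Im (Z p) -
      (- (fst p / L) * ln (2 * Re (Z p) / S) - gam x \<beta> J K * fst p * ln (1 / fst p))
      = Im (r p) + fst p / L * (ln (Re (Z p)) - ln (a p))"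
    using ev Re_pos
  proof eventually_elim
    case (elim p)
    then have "a p > 0" using a_pos by blast
    have "Re (lg (of_real (w p))) = ln \<bar>w p\<bar>"
      using Re_log_branch[OF lg, of "of_real (w p)"] w_nz[OF \<open>a p > 0\<close>] by simp
    also have "\<dots> = 2 * (ln S - ln 2 - ln (a p))"
      using \<open>a p > 0\<close> \<open>S > 0\<close> by (simp add: abs_w ln_realpow ln_div ln_mult)
    finally have Re_lg: "Re (lg (of_real (w p))) = 2 * (ln S - ln 2 - ln (a p))" .
    have *: "fst p / (2 * L) * Re (lg (of_real (w p))) = fst p / L * (ln S - ln 2 - ln (a p))"
      unfolding Re_lg using \<open>L > 0\<close> by (simp add: field_simps)
    have "ln (2 * Re (Z p) / S) = ln 2 + ln (Re (Z p)) - ln S"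
      using elim \<open>S > 0\<close> by (simp add: ln_div ln_mult)
    then show ?case unfolding Im_Z * by (simp only:) (simp add: algebra_simps)
  qed
  from landau_o.small.in_cong[OF this] small
  show ?thesis
    unfolding case_prod_beta' F_def Z_def S_def L_def by simp
qed

text \<open>This guarantees that the strengths of an associated pair are nonzero.\<close>
lemma associated_pair_in_range:
  assumes "associated_pair N x \<beta> g j k"
  shows "j \<in> {1..N}" "k \<in> {1..N}"
proof -
  obtain j1 k1 j2 k2 where range: "1 \<le> j1" "j1 < k1" "k1 \<le> N" "1 \<le> j2" "j2 < k2" "k2 \<le> N"
    and sym_diff: "{j, k} = ({j1, k1} - {j2, k2}) \<union> ({j2, k2} - {j1, k1})"
    using assms unfolding associated_pair_def by (elim conjE exE) (rule that)
  have "{j, k} \<subseteq> {j1, k1} \<union> {j2, k2}"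
    unfolding sym_diff by blast
  also have "\<dots> \<subseteq> {1..N}" using range by simp
  finally show "j \<in> {1..N}" "k \<in> {1..N}" by simp_all
qed

theorem corollary5:
  fixes N J K :: nat and x C \<beta> :: "nat \<Rightarrow> real" and M :: real and lg :: "complex \<Rightarrow> complex"
  assumes "N \<ge> 2"
    and "strict_mono_on {1..N} x"
    and "\<And>j. j \<in> {1..N} \<Longrightarrow> C j \<noteq> 0"
    and "\<And>j. j \<in> {1..N} \<Longrightarrow> \<beta> j > 0"
    and "unique_slopes N x \<beta>"
    and "dominant_pair N x \<beta> J K"
    and "M > 0"
    and "log_branch lg"
  shows "(\<forall>z. dominant_string N x C \<beta> M lg J K z \<longrightarrow>
      (\<lambda>(h, m). Im (z h m) -
         (- (h / (x K - x J)) * ln (2 * Re (z h m) / sqrt \<bar>C J * C K\<bar>)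
          - gam x \<beta> J K * h * ln (1 / h)))
      \<in> o[string_filter M (x K - x J)](\<lambda>(h, m). h)) \<and>
    (\<forall>g \<in> newton_slopes N x \<beta> - {gam x \<beta> J K}. \<forall>j k. associated_pair N x \<beta> g j k \<longrightarrow>
      (\<forall>z. flat_string N x C \<beta> M lg j k (C j / C k) z \<longrightarrow>
        (\<lambda>(h, m). Im (z h m) -
           (- (h / (x k - x j)) * ln (sqrt \<bar>C k / C j\<bar>)
            - gam_tilde x \<beta> j k * h * ln (1 / h)))
        \<in> o[string_filter M (x k - x j)](\<lambda>(h, m). h)) \<and>
      (\<beta> j < \<beta> k \<longrightarrow> (\<forall>z. flat_string N x C \<beta> M lg j k (C k / C j) z \<longrightarrow>
        (\<lambda>(h, m). Im (z h m) -
           (- (h / (x k - x j)) * ln (sqrt \<bar>C j / C k\<bar>)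
            - gam_tilde x \<beta> j k * h * ln (1 / h)))
        \<in> o[string_filter M (x k - x j)](\<lambda>(h, m). h))))"
proof (intro conjI ballI allI impI)
  fix z assume "dominant_string N x C \<beta> M lg J K z"
  moreover have JK: "J \<in> {1..N}" "K \<in> {1..N}" "J < K"
    using assms(6) unfolding dominant_pair_def by auto
  moreover have "x J < x K" using strict_mono_onD[OF assms(2) JK] .
  ultimately show "(\<lambda>(h, m). Im (z h m) -
         (- (h / (x K - x J)) * ln (2 * Re (z h m) / sqrt \<bar>C J * C K\<bar>)
          - gam x \<beta> J K * h * ln (1 / h)))
      \<in> o[string_filter M (x K - x J)](\<lambda>(h, m). h)"
    using assms(3,7,8) by (intro dominant_string_Im) auto
next
  fix g j k z
  assume "associated_pair N x \<beta> g j k"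
  then have "C j \<noteq> 0" "C k \<noteq> 0" using associated_pair_in_range assms(3) by blast+
  moreover assume "flat_string N x C \<beta> M lg j k (C j / C k) z"
  ultimately show "(\<lambda>(h, m). Im (z h m) -
           (- (h / (x k - x j)) * ln (sqrt \<bar>C k / C j\<bar>)
            - gam_tilde x \<beta> j k * h * ln (1 / h)))
        \<in> o[string_filter M (x k - x j)](\<lambda>(h, m). h)"
    using flat_string_Im[OF assms(8), of "C j / C k"] by simp
next
  fix g j k z
  assume "associated_pair N x \<beta> g j k"
  then have "C j \<noteq> 0" "C k \<noteq> 0" using associated_pair_in_range assms(3) by blast+
  moreover assume "flat_string N x C \<beta> M lg j k (C k / C j) z"
  ultimately show "(\<lambda>(h, m). Im (z h m) -
           (- (h / (x k - x j)) * ln (sqrt \<bar>C j / C k\<bar>)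
            - gam_tilde x \<beta> j k * h * ln (1 / h)))
        \<in> o[string_filter M (x k - x j)](\<lambda>(h, m). h)"
    using flat_string_Im[OF assms(8), of "C k / C j"] by simp
qed

end
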